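(* Let $1<\beta_1\leq\beta_2$, and let $X(t)=(X_1(t),X_2(t))\in\mathbb{N}^2$, $t\in\{0,1,2,\dots\}$, be the discrete time Markov chain which from a state $(x,y)$ moves to $(x+1,y)$ with probability $\frac{x^{\beta_1}}{x^{\beta_1}+y^{\beta_2}}$ and to $(x,y+1)$ with probability $\frac{y^{\beta_2}}{x^{\beta_1}+y^{\beta_2}}$. For $i=1,2$ let $A_i$ be the event that all but finitely many balls are placed in bin $i$. Put $$\alpha_{cr}=\frac{\beta_1-1}{\beta_2-1},\qquad \nu_{cr}=\alpha_{cr}^{\frac{1}{\beta_2-1}}=\left(\frac{\beta_1-1}{\beta_2-1}\right)^{\frac{1}{\beta_2-1}}.$$ Assume that $\mathbf{x}=(x,y)\in\mathbb{N}^2$, where $y=y(x)=\nu x^{\alpha}+o(x^{\alpha})$ as $x\to\infty$, for some $\alpha\in(0,1)$ and $\nu>0$. 1) If either $\alpha<\alpha_{cr}$, or $\alpha=\alpha_{cr}$ and $\nu<\nu_{cr}$, then $\lim_{x\to\infty}\mathsf{P}_{\mathbf{x}}(A_1)=1$. 2) If either $\alpha>\alpha_{cr}$, or $\alpha=\alpha_{cr}$ and $\nu>\nu_{cr}$, then $\lim_{x\to\infty}\mathsf{P}_{\mathbf{x}}(A_2)=1$.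
   Context: $\mathbb{N}=\{1,2,\dots\}$. $X_i(t)$ is the number of balls in bin $i$ at time $t$; at each time step exactly one ball is added, to bin 1 (the first coordinate increases by 1) or to bin 2 (the second coordinate increases by 1). $A_i$ is the event that from some finite time on every ball is placed in bin $i$. $\mathsf{P}_{\mathbf{x}}$ denotes the distribution of the chain started at $\mathbf{x}$. *)

theory Defs
  imports "HOL-Probability.Probability" "HOL-Library.Landau_Symbols"
begin

(* X is a time-homogeneous Markov chain on (the probability space) M with one-step
   law K and initial state s.  Conditioning is on the full past, and only on pasts of
   positive probability, so that the library's division by 0 plays no role. *)
locale markov_chain = prob_space M
  for M :: "'w measure" and X :: "nat \<Rightarrow> 'w \<Rightarrow> 's" and K :: "'s \<Rightarrow> 's pmf" and s :: 's +
  assumes measurable_X: "\<And>t. X t \<in> measurable M (count_space UNIV)"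
    and initial: "\<P>(\<omega> in M. X 0 \<omega> = s) = 1"
    and transition: "\<And>t h s'. \<P>(\<omega> in M. \<forall>i\<le>t. X i \<omega> = h i) > 0 \<Longrightarrow>
      \<P>(\<omega> in M. X (Suc t) \<omega> = s' \<bar> \<forall>i\<le>t. X i \<omega> = h i) = pmf (K (h t)) s'"

(* Such chains exist on path space, with X the coordinate process (Ionescu-Tulcea). *)
lemma markov_chain_exists:
  fixes K :: "'s::countable \<Rightarrow> 's pmf"
  shows "\<exists>P :: 's \<Rightarrow> (nat \<Rightarrow> 's) measure. \<forall>s. markov_chain (P s) (\<lambda>t \<omega>. \<omega> t) K s"
proof (intro choice allI)
  fix s :: 's
  let ?N = "\<lambda>_::nat. count_space (UNIV :: 's set)"
  define Q where "Q n \<omega> = measure_pmf (case n of 0 \<Rightarrow> return_pmf s | Suc m \<Rightarrow> K (\<omega> m))"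
    for n and \<omega> :: "nat \<Rightarrow> 's"
  have Q_meas: "Q n \<in> measurable (PiM {0..<n} ?N) (subprob_algebra (?N n))" for n
  proof (cases n)
    case 0
    then show ?thesis unfolding Q_def by (auto intro!: measurable_const measure_pmf_in_subprob_algebra)
  next
    case (Suc m)
    have "(\<lambda>\<omega>. \<omega> m) \<in> measurable (PiM {0..<n} ?N) (count_space UNIV)"
      using Suc by (intro measurable_component_singleton) auto
    moreover have "(\<lambda>a. measure_pmf (K a)) \<in> measurable (count_space UNIV) (subprob_algebra (?N n))"
      by (auto intro: measure_pmf_in_subprob_algebra)
    ultimately show ?thesis
      unfolding Q_def Suc by (auto intro: measurable_compose)
  qed
  interpret IT: Ionescu_Tulcea Q ?N
  proof (rule Ionescu_Tulcea.intro)
    show "Q n \<in> measurable (PiM {0..<n} ?N) (subprob_algebra (?N n))" for n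
      by (rule Q_meas)
    show "prob_space (Q n \<omega>)" if "\<omega> \<in> space (PiM {0..<n} ?N)" for n \<omega>
      unfolding Q_def by (rule prob_space_measure_pmf)
  qed
  let ?L = "IT.PF.lim"
  have single: "{restrict h {0..<n}} \<in> sets (PiM {0..<n} ?N)" for n and h :: "nat \<Rightarrow> 's"
  proof -
    have "{restrict h {0..<n}} = (\<Pi>\<^sub>E i\<in>{0..<n}. {h i})"
      by (auto simp: PiE_iff fun_eq_iff extensional_def restrict_def)
    then show ?thesis by (auto intro!: sets_PiM_I_finite)
  qed
  have C_step: "emeasure (IT.C 0 n (\<lambda>_. undefined)) {restrict h {0..<n}} = (\<Prod>i<n. emeasure (Q i h) {h i})"
    for n and h :: "nat \<Rightarrow> 's"
  proof (induction n)
    case 0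
    show ?case using single[of h 0] by (simp add: restrict_def)
  next
    case (Suc n)
    let ?C = "IT.C 0 n (\<lambda>_. undefined)"
    let ?u = "\<lambda>_::nat. undefined :: 's"
    have u: "?u \<in> space (PiM {0..<0} ?N)" by (simp add: space_PiM)
    have sC: "sets ?C = sets (PiM {0..<n} ?N)" and spC: "space ?C = space (PiM {0..<n} ?N)"
      using IT.sets_C[OF u, of n] IT.space_C[OF u, of n] by simp_all
    have meas: "IT.eP n \<in> measurable ?C (subprob_algebra (PiM {0..<Suc n} ?N))"
      using IT.measurable_eP[of n] by (simp cong: measurable_cong_sets add: sC)
    have ne: "space ?C \<noteq> {}"
      using spC by (simp add: space_PiM_empty_iff)
    have "emeasure (IT.C 0 (Suc n) ?u) {restrict h {0..<Suc n}}
        = (\<integral>\<^sup>+\<omega>. emeasure (IT.eP n \<omega>) {restrict h {0..<Suc n}} \<partial>?C)"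
      using emeasure_bind[OF ne meas single[of h "Suc n"]] by simp
    also have "\<dots> = (\<integral>\<^sup>+\<omega>. emeasure (Q n h) {h n} * indicator {restrict h {0..<n}} \<omega> \<partial>?C)"
    proof (rule nn_integral_cong)
      fix \<omega> assume "\<omega> \<in> space ?C"
      then have w: "\<omega> \<in> space (PiM {0..<n} ?N)" by (simp add: spC)
      have ext: "\<omega> i = undefined" if "i \<ge> n" for i
        using w that by (auto simp: space_PiM PiE_iff extensional_def)
      have iff: "fun_upd \<omega> n x = restrict h {0..<Suc n} \<longleftrightarrow> x = h n \<and> \<omega> = restrict h {0..<n}" for x
        using ext unfolding fun_eq_iff by (auto simp: restrict_def less_Suc_eq)
      have Qh: "Q n (restrict h {0..<n}) = Q n h"
        unfolding Q_def by (cases n) auto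
      have "emeasure (IT.eP n \<omega>) {restrict h {0..<Suc n}} =
          emeasure (Q n \<omega>) {x. fun_upd \<omega> n x = restrict h {0..<Suc n}}"
        using IT.emeasure_eP[OF w single] by (simp add: vimage_def)
      also have "\<dots> = emeasure (Q n h) {h n} * indicator {restrict h {0..<n}} \<omega>"
        unfolding iff using Qh by (cases "\<omega> = restrict h {0..<n}") auto
      finally show "emeasure (IT.eP n \<omega>) {restrict h {0..<Suc n}} = \<dots>" .
    qed
    also have "\<dots> = emeasure (Q n h) {h n} * emeasure ?C {restrict h {0..<n}}"
      using single[of h n] by (subst nn_integral_cmult_indicator) (auto simp: sC)
    finally show ?case unfolding Suc prod.lessThan_Suc by (simp only: mult.commute)
  qed
  have cyl: "emeasure ?L {\<omega>. \<forall>i<n. \<omega> i = h i} = (\<Prod>i<n. emeasure (Q i h) {h i})"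
    for n and h :: "nat \<Rightarrow> 's"
  proof -
    have emb: "prod_emb UNIV ?N {0..<n} {restrict h {0..<n}} = {\<omega>. \<forall>i<n. \<omega> i = h i}"
      by (auto simp: prod_emb_def fun_eq_iff restrict_def) metis
    have emb': "prod_emb {0..<n} ?N {0..<n} {restrict h {0..<n}} = {restrict h {0..<n}}"
      by (auto simp: prod_emb_def space_PiM PiE_iff extensional_def fun_eq_iff restrict_def) metis
    have "emeasure ?L {\<omega>. \<forall>i<n. \<omega> i = h i} = emeasure (IT.CI {0..<n}) {restrict h {0..<n}}"
      using IT.lim[OF _ single[of h n]] unfolding emb by (simp only: finite_atLeastLessThan)
    also have "\<dots> = emeasure (IT.C 0 n (\<lambda>_. undefined)) {restrict h {0..<n}}"
      using IT.emeasure_CI[OF subset_refl single[of h n]] unfolding emb' .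
    finally show ?thesis unfolding C_step .
  qed
  have cylm: "measure ?L {\<omega>. \<forall>i<n. \<omega> i = h i} = (\<Prod>i<n. measure (Q i h) {h i})"
    for n and h :: "nat \<Rightarrow> 's"
    unfolding measure_def cyl Q_def
    by (simp add: measure_pmf.emeasure_eq_measure prod_ennreal prod_nonneg)
  have "markov_chain ?L (\<lambda>t \<omega>. \<omega> t) K s"
  proof (intro markov_chain.intro markov_chain_axioms.intro)
    show "prob_space ?L"
      using cyl[of 0] by (intro prob_spaceI) (simp add: space_PiM)
    show "(\<lambda>\<omega>. \<omega> t) \<in> measurable ?L (count_space UNIV)" for t
      unfolding measurable_cong_sets[OF IT.PF.sets_lim refl]
      by (rule measurable_component_singleton) simp
    show "\<P>(\<omega> in ?L. \<omega> 0 = s) = 1"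
      using cylm[of 1 "\<lambda>_. s"] by (simp add: space_PiM Q_def)
    fix t h s' assume pos: "\<P>(\<omega> in ?L. \<forall>i\<le>t. \<omega> i = h i) > 0"
    define h' where "h' = fun_upd h (Suc t) s'"
    have 1: "{\<omega> \<in> space ?L. \<forall>i\<le>t. \<omega> i = h i} = {\<omega>. \<forall>i<Suc t. \<omega> i = h i}"
      by (auto simp: space_PiM less_Suc_eq_le)
    have 2: "{\<omega> \<in> space ?L. \<omega> (Suc t) = s' \<and> (\<forall>i\<le>t. \<omega> i = h i)} = {\<omega>. \<forall>i<Suc (Suc t). \<omega> i = h' i}"
      by (auto simp: space_PiM less_Suc_eq_le h'_def le_Suc_eq)
    have "(\<Prod>i<Suc t. measure (Q i h') {h' i}) = (\<Prod>i<Suc t. measure (Q i h) {h i})"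
      by (intro prod.cong) (auto simp: h'_def Q_def split: nat.split)
    moreover have "measure (Q (Suc t) h') {h' (Suc t)} = pmf (K (h t)) s'"
      by (simp add: h'_def Q_def measure_pmf_single)
    ultimately have "measure ?L {\<omega>. \<forall>i<Suc (Suc t). \<omega> i = h' i}
        = measure ?L {\<omega>. \<forall>i<Suc t. \<omega> i = h i} * pmf (K (h t)) s'"
      unfolding cylm by (subst prod.lessThan_Suc) simp
    then show "\<P>(\<omega> in ?L. \<omega> (Suc t) = s' \<bar> \<forall>i\<le>t. \<omega> i = h i) = pmf (K (h t)) s'"
      using pos unfolding cond_prob_def 1 2 by simp
  qed
  then show "\<exists>P. markov_chain P (\<lambda>t (\<omega> :: nat \<Rightarrow> 's). \<omega> t) K s" by blast
qed

(* States are pairs (x, y) with x, y >= 1; the value at other pairs is irrelevant. *)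
definition urn_step :: "real \<Rightarrow> real \<Rightarrow> nat \<times> nat \<Rightarrow> (nat \<times> nat) pmf" where
  "urn_step \<beta>1 \<beta>2 = (\<lambda>(x, y).
     map_pmf (\<lambda>first. if first then (x + 1, y) else (x, y + 1))
       (bernoulli_pmf (real x powr \<beta>1 / (real x powr \<beta>1 + real y powr \<beta>2))))"

(* The transition probabilities in explicit form. *)
lemma pmf_urn_step:
  assumes "x \<ge> 1" "y \<ge> 1"
  shows "pmf (urn_step \<beta>1 \<beta>2 (x, y)) (x + 1, y) = real x powr \<beta>1 / (real x powr \<beta>1 + real y powr \<beta>2)"
    and "pmf (urn_step \<beta>1 \<beta>2 (x, y)) (x, y + 1) = real y powr \<beta>2 / (real x powr \<beta>1 + real y powr \<beta>2)"
proof -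
  let ?f = "\<lambda>first. if first then (x + 1, y) else (x, y + 1)"
  let ?p = "real x powr \<beta>1 / (real x powr \<beta>1 + real y powr \<beta>2)"
  have pos: "real x powr \<beta>1 > 0" "real y powr \<beta>2 > 0"
    using assms by auto
  then have p: "0 \<le> ?p" "?p \<le> 1"
    using add_pos_pos[OF pos] by simp_all
  have inj: "inj ?f"
    by (auto simp: inj_def)
  show "pmf (urn_step \<beta>1 \<beta>2 (x, y)) (x + 1, y) = ?p"
    using pmf_map_inj'[OF inj, of "bernoulli_pmf ?p" True] p by (simp add: urn_step_def)
  have "1 - ?p = real y powr \<beta>2 / (real x powr \<beta>1 + real y powr \<beta>2)"
    using add_pos_pos[OF pos] by (auto simp: field_simps simp flip: add_divide_distrib)
  then show "pmf (urn_step \<beta>1 \<beta>2 (x, y)) (x, y + 1) = real y powr \<beta>2 / (real x powr \<beta>1 + real y powr \<beta>2)"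
    using pmf_map_inj'[OF inj, of "bernoulli_pmf ?p" False] p by (simp add: urn_step_def)
qed

definition all_but_finitely_many_in_bin1 :: "(nat \<Rightarrow> nat \<times> nat) \<Rightarrow> bool" where
  "all_but_finitely_many_in_bin1 z \<longleftrightarrow>
     (\<exists>T. \<forall>t\<ge>T. z (Suc t) = (fst (z t) + 1, snd (z t)))"

definition all_but_finitely_many_in_bin2 :: "(nat \<Rightarrow> nat \<times> nat) \<Rightarrow> bool" where
  "all_but_finitely_many_in_bin2 z \<longleftrightarrow>
     (\<exists>T. \<forall>t\<ge>T. z (Suc t) = (fst (z t), snd (z t) + 1))"

definition \<alpha>_cr :: "real \<Rightarrow> real \<Rightarrow> real" where
  "\<alpha>_cr \<beta>1 \<beta>2 = (\<beta>1 - 1) / (\<beta>2 - 1)"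

definition \<nu>_cr :: "real \<Rightarrow> real \<Rightarrow> real" where
  "\<nu>_cr \<beta>1 \<beta>2 = \<alpha>_cr \<beta>1 \<beta>2 powr (1 / (\<beta>2 - 1))"

end

theory Submission
  imports Defs
begin

text \<open>
  Write $F(x) = \sum_{k \ge x} k^{-\beta_1}$ and $G(y) = \sum_{k \ge y} k^{-\beta_2}$. A ball
  in bin 1 lowers $F$ by $x^{-\beta_1}$ and a ball in bin 2 lowers $G$ by $y^{-\beta_2}$; these
  amounts are inversely proportional to the probabilities of the two moves, so the gap
  $M_t = F(X_1(t)) - G(X_2(t))$ is a bounded martingale. For the same reason the conditional
  variance of one step of $M$ equals the expected decrease of
  $V(x, y) = \sum_{k \ge x} k^{-2\beta_1} + \sum_{k \ge y} k^{-2\beta_2}$, that is,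
  $(M_t - M_0)^2 + V(X(t))$ is again a martingale (\<open>urn_second_moment_harmonic\<close>). Hence the
  variance of $M_t$ is at most $V(X(0))$ at all times, and Chebyshev's inequality keeps $M_t$
  within $|M_0|/2$ of $M_0$, with probability at least $1 - 4 V(X(0)) / M_0^2$
  (\<open>urn_Chebyshev\<close>).

  The sign of the gap decides the winner. If $M_0 < 0$ and $M_t < M_0/2$, then
  $G(X_2(t)) > |M_0|/2$. Since $G$ tends to 0, this bounds $X_2(t)$ by a number that does not depend
  on $t$; and since $X_2$ is nondecreasing, a bound that holds with probability at least $p$ at
  each fixed time holds with probability at least $p$ at all times together
  (\<open>prob_bounded_of_mono\<close>). A bounded second coordinate means that from some time on every
  ball goes to bin 1. The case $M_0 > 0$ is the same with the bins exchanged. This gives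
  \<open>prob_bin1_ge\<close> and \<open>prob_bin2_ge\<close>.

  The rest is asymptotics. Comparison with the integral gives
  $F(x) \sim x^{1-\beta_1} / (\beta_1 - 1)$, so that the tail of squares is negligible against the
  square of the powr_tail (\<open>powr_tail_variance_ratio\<close>). It follows that $V / M_0^2 \to 0$ as soon as
  one of the quotients $F(x) / G(y(x))$ and $G(y(x)) / F(x)$ tends to a limit below 1
  (\<open>relative_gap_tendsto_0\<close>). For $y \sim \nu x^\alpha$ the quotient $F(x) / G(y)$ is
  asymptotically $(\nu^{\beta_2 - 1} / \alpha_{cr}) x^{\alpha(\beta_2-1) - (\beta_1-1)}$
  (\<open>powr_tail_quotient_asymptotic\<close>): the exponent changes sign at $\alpha = \alpha_{cr}$, and at that
  value the constant passes through 1 at $\nu = \nu_{cr}$.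
\<close>

section \<open>The law of a Markov chain and its nonnegative superharmonic functions\<close>

text \<open>
  The transition law is given conditionally on the whole past, so the induction on time has to run
  over complete histories: the law of a single state cannot be propagated directly.
\<close>

primrec path_law :: "('s \<Rightarrow> 's pmf) \<Rightarrow> 's \<Rightarrow> nat \<Rightarrow> 's list pmf" where
  "path_law K s 0 = return_pmf [s]"
| "path_law K s (Suc t) =
     bind_pmf (path_law K s t) (\<lambda>l. map_pmf (\<lambda>b. l @ [b]) (K (last l)))"

definition history :: "(nat \<Rightarrow> 'w \<Rightarrow> 's) \<Rightarrow> nat \<Rightarrow> 'w \<Rightarrow> 's list" where
  "history X t \<omega> = map (\<lambda>i. X i \<omega>) [0..<Suc t]"

lemma history_Suc: "history X (Suc t) \<omega> = history X t \<omega> @ [X (Suc t) \<omega>]"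
  by (simp add: history_def)

lemma last_history: "last (history X t \<omega>) = X t \<omega>"
  by (simp add: history_def)

lemma history_eq_iff:
  "history X t \<omega> = l \<longleftrightarrow> length l = Suc t \<and> (\<forall>i\<le>t. X i \<omega> = l ! i)"
  unfolding history_def by (auto simp: list_eq_iff_nth_eq less_Suc_eq_le simp del: upt_Suc)

lemma pmf_path_law_snoc:
  "pmf (path_law K s (Suc t)) (l @ [b]) = pmf (path_law K s t) l * pmf (K (last l)) b"
proof -
  have "pmf (map_pmf (\<lambda>b. l' @ [b]) (K (last l'))) (l @ [b])
      = pmf (K (last l)) b * indicator {l} l'" for l'
  proof (cases "l' = l")
    case True
    then show ?thesis
      using pmf_map_inj'[of "\<lambda>b. l @ [b]" "K (last l)" b] by (simp add: inj_def)
  next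
    case False
    then show ?thesis by (auto intro!: pmf_map_outside)
  qed
  then show ?thesis
    by (simp add: pmf_bind measure_pmf_single)
qed

lemma pmf_path_law_Nil: "pmf (path_law K s t) [] = 0"
  by (cases t) (auto simp: pmf_eq_0_set_pmf)

lemma measurable_history:
  fixes X :: "nat \<Rightarrow> 'w \<Rightarrow> 's :: countable"
  assumes "\<And>t. X t \<in> measurable M (count_space UNIV)"
  shows "history X t \<in> measurable M (count_space UNIV)"
proof (subst measurable_count_space_eq2_countable, safe)
  note assms[measurable]
  fix l :: "'s list"
  have "history X t -` {l} \<inter> space M = {\<omega> \<in> space M. history X t \<omega> = l}"
    by auto
  also have "\<dots> \<in> sets M" unfolding history_eq_iff by measurable
  finally show "history X t -` {l} \<inter> space M \<in> sets M" .
qed auto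

text \<open>
  The product form of the transition law, which covers pasts of probability 0 as well.
\<close>

lemma (in markov_chain) prob_extend_history:
  "measure M {\<omega> \<in> space M. X (Suc t) \<omega> = b \<and> (\<forall>i\<le>t. X i \<omega> = h i)}
     = measure M {\<omega> \<in> space M. \<forall>i\<le>t. X i \<omega> = h i} * pmf (K (h t)) b"
proof (cases "measure M {\<omega> \<in> space M. \<forall>i\<le>t. X i \<omega> = h i} > 0")
  case True
  then show ?thesis using transition[of t h b] by (simp add: cond_prob_def field_simps)
next
  case False
  note measurable_X[measurable]
  have 0: "measure M {\<omega> \<in> space M. \<forall>i\<le>t. X i \<omega> = h i} = 0"
    using False zero_less_measure_iff by blast
  have "measure M {\<omega> \<in> space M. X (Suc t) \<omega> = b \<and> (\<forall>i\<le>t. X i \<omega> = h i)}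
      \<le> measure M {\<omega> \<in> space M. \<forall>i\<le>t. X i \<omega> = h i}"
    by (intro finite_measure_mono) auto
  with 0 measure_nonneg[of M] show ?thesis by (simp add: order_antisym)
qed

text \<open>
  On a countable state space there are countably many histories, so the two measures need only be
  compared on single histories, where the transition law is the recursion of \<open>path_law\<close>.
\<close>

lemma distr_history:
  fixes s :: "'s :: countable"
  assumes "markov_chain M X K s"
  shows "distr M (count_space UNIV) (history X t) = measure_pmf (path_law K s t)"
proof -
  interpret markov_chain M X K s by fact
  note measurable_X[measurable]
  note [measurable] = measurable_history[of X M, OF measurable_X]
  have *: "measure M {\<omega> \<in> space M. history X t \<omega> = l} = pmf (path_law K s t) l" for l
  proof (induction t arbitrary: l)
    case 0
    show ?case
    proof (cases "l = [s]")
      case True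
      then show ?thesis using initial by (simp add: history_def)
    next
      case False
      \<comment> \<open>The event is disjoint from one of probability 1, so it is null.\<close>
      have "{\<omega> \<in> space M. history X 0 \<omega> = l} \<inter> {\<omega> \<in> space M. X 0 \<omega> = s} = {}"
        using False by (auto simp: history_def)
      moreover have "measure M {\<omega> \<in> space M. X 0 \<omega> = s} = 1" using initial by simp
      moreover have "{\<omega> \<in> space M. history X 0 \<omega> = l} \<in> sets M" "{\<omega> \<in> space M. X 0 \<omega> = s} \<in> sets M"
        by measurable
      ultimately have "measure M {\<omega> \<in> space M. history X 0 \<omega> = l} + 1 \<le> 1"
        using finite_measure_Union[of "{\<omega> \<in> space M. history X 0 \<omega> = l}" "{\<omega> \<in> space M. X 0 \<omega> = s}"]
          prob_le_1[of "{\<omega> \<in> space M. history X 0 \<omega> = l} \<union> {\<omega> \<in> space M. X 0 \<omega> = s}"] by simp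
      then have "measure M {\<omega> \<in> space M. history X 0 \<omega> = l} = 0"
        using measure_nonneg[of M] by (simp add: order_antisym)
      with False show ?thesis by simp
    qed
  next
    case (Suc t)
    show ?case
    proof (cases l rule: rev_cases)
      case Nil
      then show ?thesis by (simp add: pmf_path_law_Nil history_def del: path_law.simps)
    next
      case (snoc l' b)
      have iff: "history X (Suc t) \<omega> = l \<longleftrightarrow> X (Suc t) \<omega> = b \<and> history X t \<omega> = l'" for \<omega>
        using snoc by (auto simp: history_Suc)
      show ?thesis
      proof (cases "length l' = Suc t")
        case True
        then have "last l' = l' ! t" by (metis diff_Suc_1 last_conv_nth length_0_conv nat.simps(3))
        then show ?thesis
          using prob_extend_history[of t b "\<lambda>i. l' ! i"] Suc[of l'] True
          unfolding iff by (simp add: snoc pmf_path_law_snoc history_eq_iff del: path_law.simps)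
      next
        case False
        then show ?thesis
          using Suc[of l'] unfolding iff
          by (simp add: snoc pmf_path_law_snoc history_eq_iff del: path_law.simps)
      qed
    qed
  qed
  show ?thesis
  proof (rule measure_eqI_countable[where A = UNIV])
    fix l :: "'s list"
    have "emeasure (distr M (count_space UNIV) (history X t)) {l}
        = emeasure M {\<omega> \<in> space M. history X t \<omega> = l}"
      by (subst emeasure_distr) (auto intro!: arg_cong[where f = "emeasure M"])
    also have "\<dots> = emeasure (path_law K s t) {l}"
      by (simp add: emeasure_eq_measure * emeasure_pmf_single)
    finally show "emeasure (distr M (count_space UNIV) (history X t)) {l} = \<dots>" .
  qed auto
qed

lemma AE_steps:
  fixes s :: "'s :: countable"
  assumes "markov_chain M X K s"
  shows "AE \<omega> in M. X 0 \<omega> = s \<and> (\<forall>t. X (Suc t) \<omega> \<in> set_pmf (K (X t \<omega>)))"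
proof -
  interpret markov_chain M X K s by fact
  note [measurable] = measurable_history[of X M, OF measurable_X]
  have in_law: "AE \<omega> in M. history X t \<omega> \<in> set_pmf (path_law K s t)" for t
  proof -
    have "AE l in distr M (count_space UNIV) (history X t). l \<in> set_pmf (path_law K s t)"
      unfolding distr_history[OF assms] by (simp add: AE_measure_pmf)
    then show ?thesis by (subst (asm) AE_distr_iff) auto
  qed
  have "AE \<omega> in M. \<forall>t. history X t \<omega> \<in> set_pmf (path_law K s t)"
    using in_law by (simp add: AE_all_countable)
  then show ?thesis
  proof eventually_elim
    case (elim \<omega>)
    have "X (Suc t) \<omega> \<in> set_pmf (K (X t \<omega>))" for t
      using elim[rule_format, of "Suc t"] by (auto simp: history_Suc simp flip: last_history[of X t \<omega>])
    with elim[rule_format, of 0] show ?case by (auto simp: history_def)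
  qed
qed

lemma nn_integral_Suc:
  fixes s :: "'s :: countable"
  assumes "markov_chain M X K s"
  shows "(\<integral>\<^sup>+\<omega>. \<phi> (X (Suc t) \<omega>) \<partial>M) = (\<integral>\<^sup>+\<omega>. (\<integral>\<^sup>+b. \<phi> b \<partial>K (X t \<omega>)) \<partial>M)"
proof -
  interpret markov_chain M X K s by fact
  note [measurable] = measurable_history[of X M, OF measurable_X]
  have law: "(\<integral>\<^sup>+\<omega>. f (X t \<omega>) \<partial>M) = (\<integral>\<^sup>+l. f (last l) \<partial>path_law K s t)" for f t
  proof -
    have "(\<integral>\<^sup>+l. f (last l) \<partial>distr M (count_space UNIV) (history X t)) = (\<integral>\<^sup>+\<omega>. f (X t \<omega>) \<partial>M)"
      by (subst nn_integral_distr) (auto simp: last_history)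
    then show ?thesis by (simp add: distr_history[OF assms(1)])
  qed
  show ?thesis
    unfolding law[of \<phi> "Suc t"] law[of "\<lambda>a. \<integral>\<^sup>+b. \<phi> b \<partial>K a" t] by simp
qed

text \<open>
  The expectation of \<open>\<phi> (X t)\<close> does not increase with \<open>t\<close>, which leaves Markov's inequality. The
  set \<open>S\<close> restricts superharmonicity to states that the chain can reach; for the urn these are the
  states without an empty bin. Nonnegativity lets the argument run with nonnegative integrals, so that no
  integrability has to be checked.
\<close>

lemma superharmonic_Markov_inequality:
  fixes s :: "'s :: countable" and \<phi> :: "'s \<Rightarrow> real"
  assumes mc: "markov_chain M X K s" and nonneg: "\<And>a. \<phi> a \<ge> 0"
    and S: "s \<in> S" "\<And>a. a \<in> S \<Longrightarrow> set_pmf (K a) \<subseteq> S"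
    and super: "\<And>a. a \<in> S \<Longrightarrow> (\<integral>\<^sup>+b. \<phi> b \<partial>K a) \<le> \<phi> a"
    and c: "c > 0"
  shows "\<P>(\<omega> in M. c \<le> \<phi> (X t \<omega>)) \<le> \<phi> s / c"
proof -
  interpret markov_chain M X K s by fact
  note measurable_X[measurable]
  have "(\<integral>\<^sup>+\<omega>. \<phi> (X t \<omega>) \<partial>M) \<le> \<phi> s"
  proof (induction t)
    case 0
    have "AE \<omega> in M. ennreal (\<phi> (X 0 \<omega>)) \<le> \<phi> s" using AE_steps[OF mc] by eventually_elim simp
    then have "(\<integral>\<^sup>+\<omega>. \<phi> (X 0 \<omega>) \<partial>M) \<le> (\<integral>\<^sup>+\<omega>. \<phi> s \<partial>M)" by (rule nn_integral_mono_AE)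
    then show ?case by (simp add: emeasure_space_1)
  next
    case (Suc t)
    have "AE \<omega> in M. X t \<omega> \<in> S" using AE_steps[OF mc]
    proof eventually_elim
      case (elim \<omega>)
      show ?case by (induction t) (use elim S in blast)+
    qed
    then have "AE \<omega> in M. (\<integral>\<^sup>+b. \<phi> b \<partial>K (X t \<omega>)) \<le> \<phi> (X t \<omega>)"
      by eventually_elim (rule super)
    then have "(\<integral>\<^sup>+\<omega>. (\<integral>\<^sup>+b. \<phi> b \<partial>K (X t \<omega>)) \<partial>M) \<le> (\<integral>\<^sup>+\<omega>. \<phi> (X t \<omega>) \<partial>M)"
      by (rule nn_integral_mono_AE)
    with Suc show ?case
      unfolding nn_integral_Suc[OF mc, of "\<lambda>b. ennreal (\<phi> b)"] by (rule order_trans[rotated])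
  qed
  moreover have "emeasure M {\<omega> \<in> space M. c \<le> \<phi> (X t \<omega>)} * c
      = (\<integral>\<^sup>+\<omega>. ennreal c * indicator {\<omega> \<in> space M. c \<le> \<phi> (X t \<omega>)} \<omega> \<partial>M)"
    by (subst nn_integral_cmult_indicator) (auto simp: mult.commute)
  moreover have "\<dots> \<le> (\<integral>\<^sup>+\<omega>. \<phi> (X t \<omega>) \<partial>M)"
    by (intro nn_integral_mono) (auto simp: indicator_def intro: ennreal_leI)
  ultimately have "emeasure M {\<omega> \<in> space M. c \<le> \<phi> (X t \<omega>)} * c \<le> \<phi> s"
    by simp
  then have "ennreal (\<P>(\<omega> in M. c \<le> \<phi> (X t \<omega>)) * c) \<le> \<phi> s"
    using c by (simp add: emeasure_eq_measure ennreal_mult')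
  then show ?thesis using c nonneg by (simp add: field_simps)
qed

text \<open>
  For a nondecreasing sequence the events ``bounded by \<open>n\<close> up to time \<open>t\<close>'' and ``at most \<open>n\<close> at
  time \<open>t\<close>'' agree up to a null set, and the former decrease to boundedness at all times.
\<close>

lemma (in prob_space) prob_bounded_of_mono:
  fixes N :: "nat \<Rightarrow> 'a \<Rightarrow> nat"
  assumes [measurable]: "\<And>t. N t \<in> measurable M (count_space UNIV)"
    and mono: "AE \<omega> in M. \<forall>t. N t \<omega> \<le> N (Suc t) \<omega>"
    and p: "\<And>t. p \<le> \<P>(\<omega> in M. N t \<omega> \<le> n)"
  shows "p \<le> \<P>(\<omega> in M. \<forall>t. N t \<omega> \<le> n)"
proof -
  define C where "C t = {\<omega> \<in> space M. \<forall>i\<le>t. N i \<omega> \<le> n}" for t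
  have [measurable]: "C t \<in> sets M" for t unfolding C_def by measurable
  have "(\<lambda>t. measure M (C t)) \<longlonglongrightarrow> measure M (\<Inter>t. C t)"
    by (intro finite_Lim_measure_decseq) (auto simp: decseq_def C_def)
  moreover have "p \<le> measure M (C t)" for t
  proof -
    have "AE \<omega> in M. \<omega> \<in> {\<omega> \<in> space M. N t \<omega> \<le> n} \<longrightarrow> \<omega> \<in> C t"
      using mono
    proof eventually_elim
      case (elim \<omega>)
      then have "N i \<omega> \<le> N t \<omega>" if "i \<le> t" for i
        using that lift_Suc_mono_le[of "\<lambda>t. N t \<omega>"] by blast
      then show ?case by (auto simp: C_def intro: le_trans)
    qed
    then have "\<P>(\<omega> in M. N t \<omega> \<le> n) \<le> measure M (C t)"
      by (intro finite_measure_mono_AE) auto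
    with p[of t] show ?thesis by simp
  qed
  ultimately have "p \<le> measure M (\<Inter>t. C t)"
    by (intro LIMSEQ_le_const) auto
  also have "(\<Inter>t. C t) = {\<omega> \<in> space M. \<forall>t. N t \<omega> \<le> n}" by (auto simp: C_def)
  finally show ?thesis .
qed

section \<open>Tails of the series of negative powers\<close>

text \<open>
  The term with base 0 vanishes, so the value at 0 is that at 1, and the recursion in \<open>n\<close> holds from 0 on.
\<close>

definition powr_tail :: "real \<Rightarrow> nat \<Rightarrow> real" where
  "powr_tail s n = (\<Sum>k. real (k + n) powr (- s))"

lemma summable_powr_tail: "s > 1 \<Longrightarrow> summable (\<lambda>k. real (k + n) powr (- s))"
  by (intro summable_ignore_initial_segment) (simp add: summable_real_powr_iff)

lemma powr_tail_Suc: "s > 1 \<Longrightarrow> powr_tail s (Suc n) = powr_tail s n - real n powr (- s)"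
  using suminf_split_head[OF summable_powr_tail[of s n]] by (simp add: powr_tail_def)

lemma powr_tail_nonneg: "s > 1 \<Longrightarrow> powr_tail s n \<ge> 0"
  unfolding powr_tail_def by (intro suminf_nonneg summable_powr_tail) auto

text \<open>
  The mean value theorem for $x^{1-s}$: this replaces the comparison of the tail with an integral
  by one with a telescoping series.
\<close>

lemma powr_increment_bounds:
  fixes x s :: real
  assumes "s > 1" "x > 0"
  shows "x powr (1 - s) - (x + 1) powr (1 - s) \<le> (s - 1) * x powr (- s)"
    and "(s - 1) * (x + 1) powr (- s) \<le> x powr (1 - s) - (x + 1) powr (1 - s)"
proof -
  have "\<exists>z. x < z \<and> z < x + 1 \<and>
      (x + 1) powr (1 - s) - x powr (1 - s) = (x + 1 - x) * ((1 - s) * z powr (1 - s - 1))"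
    using assms by (intro MVT2 has_real_derivative_powr) auto
  then obtain z where z: "x < z" "z < x + 1"
    and eq: "x powr (1 - s) - (x + 1) powr (1 - s) = (s - 1) * z powr (- s)"
    by (auto simp: algebra_simps)
  have "z powr (- s) \<le> x powr (- s)" "(x + 1) powr (- s) \<le> z powr (- s)"
    using z assms by (auto intro!: powr_mono2')
  then show "x powr (1 - s) - (x + 1) powr (1 - s) \<le> (s - 1) * x powr (- s)"
    and "(s - 1) * (x + 1) powr (- s) \<le> x powr (1 - s) - (x + 1) powr (1 - s)"
    unfolding eq using assms by (auto intro!: mult_left_mono)
qed

lemma powr_tail_bounds:
  assumes s: "s > 1" and n: "n \<ge> 1"
  shows "real n powr (1 - s) / (s - 1) \<le> powr_tail s n"
    and "powr_tail s n \<le> real n powr (1 - s) / (s - 1) + real n powr (- s)"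
proof -
  let ?d = "\<lambda>k. real (k + n) powr (1 - s) - real (Suc k + n) powr (1 - s)"
  have "(\<lambda>k. real (k + n) powr (1 - s)) \<longlonglongrightarrow> 0"
    using s by (intro LIMSEQ_ignore_initial_segment tendsto_neg_powr filterlim_real_sequentially) auto
  from telescope_sums'[OF this] have d: "?d sums (real n powr (1 - s))" by simp
  have b: "?d k \<le> (s - 1) * real (k + n) powr (- s)"
    "(s - 1) * real (k + Suc n) powr (- s) \<le> ?d k" for k
    using powr_increment_bounds[OF s, of "real (k + n)"] n by (auto simp: algebra_simps)
  have "real n powr (1 - s) \<le> (s - 1) * powr_tail s n"
    using suminf_le[OF b(1) sums_summable[OF d] summable_mult[OF summable_powr_tail[OF s]]]
      suminf_mult[OF summable_powr_tail[OF s, of n], of "s - 1"] sums_unique[OF d] by (simp add: powr_tail_def)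
  then show "real n powr (1 - s) / (s - 1) \<le> powr_tail s n"
    using s by (simp add: field_simps)
  have "(s - 1) * powr_tail s (Suc n) \<le> real n powr (1 - s)"
    using suminf_le[OF b(2) summable_mult[OF summable_powr_tail[OF s]] sums_summable[OF d]]
      suminf_mult[OF summable_powr_tail[OF s, of "Suc n"], of "s - 1"] sums_unique[OF d] by (simp add: powr_tail_def)
  then show "powr_tail s n \<le> real n powr (1 - s) / (s - 1) + real n powr (- s)"
    using s by (simp add: powr_tail_Suc field_simps)
qed

lemma powr_tail_pos: "s > 1 \<Longrightarrow> n \<ge> 1 \<Longrightarrow> powr_tail s n > 0"
  using powr_tail_bounds(1)[of s n] by (rule less_le_trans[rotated]) auto

lemma powr_tail_asymptotic:
  assumes s: "s > 1"
  shows "(\<lambda>n. powr_tail s n * real n powr (s - 1)) \<longlonglongrightarrow> 1 / (s - 1)"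
proof (rule real_tendsto_sandwich)
  have 1: "real n powr (1 - s) * real n powr (s - 1) = 1"
    and 2: "real n powr (- s) * real n powr (s - 1) = 1 / real n" if "n \<ge> 1" for n
    using that by (simp_all add: powr_neg_one flip: powr_add)
  show "\<forall>\<^sub>F n in sequentially. 1 / (s - 1) \<le> powr_tail s n * real n powr (s - 1)"
    using eventually_ge_at_top[of 1]
  proof eventually_elim
    case (elim n)
    show ?case
      using mult_right_mono[OF powr_tail_bounds(1)[OF s elim], of "real n powr (s - 1)"] 1[OF elim] by simp
  qed
  show "\<forall>\<^sub>F n in sequentially. powr_tail s n * real n powr (s - 1) \<le> 1 / (s - 1) + 1 / real n"
    using eventually_ge_at_top[of 1]
  proof eventually_elim
    case (elim n)
    show ?case
      using mult_right_mono[OF powr_tail_bounds(2)[OF s elim], of "real n powr (s - 1)"] 1[OF elim] 2[OF elim]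
      by (simp add: distrib_right)
  qed
  show "(\<lambda>n. 1 / (s - 1) + 1 / real n) \<longlonglongrightarrow> 1 / (s - 1)"
    by (auto intro!: tendsto_eq_intros lim_1_over_n)
qed auto

lemma powr_tail_tendsto_0:
  assumes s: "s > 1"
  shows "powr_tail s \<longlonglongrightarrow> 0"
proof -
  have "(\<lambda>n. real n powr - (s - 1)) \<longlonglongrightarrow> 0"
    using s by (intro tendsto_neg_powr filterlim_real_sequentially) auto
  from tendsto_mult[OF powr_tail_asymptotic[OF s] this]
  have "(\<lambda>n. powr_tail s n * real n powr (s - 1) * real n powr - (s - 1)) \<longlonglongrightarrow> 0" by simp
  then show ?thesis
    by (rule Lim_transform_eventually)
       (use eventually_gt_at_top[of 0] in eventually_elim, simp flip: powr_add mult.assoc add: mult.assoc)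
qed

text \<open>
  The tail of squares is of order $n^{1-2s}$ and the squared tail of order $n^{2-2s}$; the missing
  factor $1/n$ is what makes Chebyshev's inequality effective far from the origin.
\<close>

lemma powr_tail_variance_ratio:
  assumes s: "s > 1"
  shows "(\<lambda>n. powr_tail (2 * s) n / (powr_tail s n)\<^sup>2) \<longlonglongrightarrow> 0"
proof -
  have "(\<lambda>n. (powr_tail (2 * s) n * real n powr (2 * s - 1)) / (powr_tail s n * real n powr (s - 1))\<^sup>2 * (1 / real n))
      \<longlonglongrightarrow> (1 / (2 * s - 1)) / (1 / (s - 1))\<^sup>2 * 0"
    using s by (intro tendsto_intros powr_tail_asymptotic lim_1_over_n) auto
  then have "(\<lambda>n. (powr_tail (2 * s) n * real n powr (2 * s - 1)) / (powr_tail s n * real n powr (s - 1))\<^sup>2 * (1 / real n))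
      \<longlonglongrightarrow> 0" by simp
  then show ?thesis
  proof (rule Lim_transform_eventually)
    show "\<forall>\<^sub>F n in sequentially.
      (powr_tail (2 * s) n * real n powr (2 * s - 1)) / (powr_tail s n * real n powr (s - 1))\<^sup>2 * (1 / real n)
        = powr_tail (2 * s) n / (powr_tail s n)\<^sup>2"
      using eventually_ge_at_top[of 1]
    proof eventually_elim
      case (elim n)
      have "real n powr (2 * s - 1) = real n powr (s - 1) * real n powr (s - 1) * real n powr 1"
        by (simp only: flip: powr_add) simp
      then show ?case using elim powr_tail_pos[OF s elim] by (simp add: power2_eq_square)
    qed
  qed
qed

section \<open>The gap martingale of the urn\<close>

lemma set_pmf_urn_step: "set_pmf (urn_step \<beta>1 \<beta>2 a) \<subseteq> {(Suc (fst a), snd a), (fst a, Suc (snd a))}"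
  by (cases a) (auto simp: urn_step_def)

definition urn_gap :: "real \<Rightarrow> real \<Rightarrow> nat \<times> nat \<Rightarrow> real" where
  "urn_gap \<beta>1 \<beta>2 a = powr_tail \<beta>1 (fst a) - powr_tail \<beta>2 (snd a)"

definition urn_variance :: "real \<Rightarrow> real \<Rightarrow> nat \<times> nat \<Rightarrow> real" where
  "urn_variance \<beta>1 \<beta>2 a = powr_tail (2 * \<beta>1) (fst a) + powr_tail (2 * \<beta>2) (snd a)"

text \<open>
  Let $f = x^{\beta_1}$, $g = y^{\beta_2}$ and $d$ the current value of the gap minus \<open>m\<close>. The
  gap moves by $-1/f$ with probability $f/(f+g)$ and by $1/g$ with probability $g/(f+g)$. The square
  terms $1/f^2$ and $1/g^2$ are exactly what the variance loses in the same move, and the cross terms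
  $-2d/f$ and $2d/g$ cancel because both are weighted to $2d/(f+g)$ in absolute value.
\<close>

lemma urn_second_moment_harmonic:
  assumes b: "1 < \<beta>1" "1 < \<beta>2" and a: "fst a \<ge> 1" "snd a \<ge> 1"
  shows "(\<integral>\<^sup>+b. (urn_gap \<beta>1 \<beta>2 b - m)\<^sup>2 + urn_variance \<beta>1 \<beta>2 b \<partial>urn_step \<beta>1 \<beta>2 a)
    = (urn_gap \<beta>1 \<beta>2 a - m)\<^sup>2 + urn_variance \<beta>1 \<beta>2 a"
proof -
  obtain x y where xy: "a = (x, y)" by (cases a)
  define f g where "f = real x powr \<beta>1" and "g = real y powr \<beta>2"
  have fg: "f > 0" "g > 0" using a by (auto simp: f_def g_def xy)
  have V: "urn_variance \<beta>1 \<beta>2 b \<ge> 0" for b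
    using b by (auto simp: urn_variance_def intro!: add_nonneg_nonneg powr_tail_nonneg)
  define p where "p = f / (f + g)"
  have p: "0 \<le> p" "p \<le> 1" and q: "1 - p = g / (f + g)"
    using fg by (auto simp: p_def field_simps)
  define d v where "d = urn_gap \<beta>1 \<beta>2 a - m" and "v = urn_variance \<beta>1 \<beta>2 a"
  have sq: "real x powr - (2 * \<beta>1) = (1 / f)\<^sup>2" "real y powr - (2 * \<beta>2) = (1 / g)\<^sup>2"
    by (simp_all add: f_def g_def power2_eq_square powr_minus_divide flip: powr_add)
  have 1: "urn_gap \<beta>1 \<beta>2 (Suc x, y) - m = d - 1 / f" "urn_variance \<beta>1 \<beta>2 (Suc x, y) = v - (1 / f)\<^sup>2"
   and 2: "urn_gap \<beta>1 \<beta>2 (x, Suc y) - m = d + 1 / g" "urn_variance \<beta>1 \<beta>2 (x, Suc y) = v - (1 / g)\<^sup>2"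
    using b sq by (simp_all add: urn_gap_def urn_variance_def d_def v_def xy powr_tail_Suc f_def g_def powr_minus_divide)
  have "(\<integral>\<^sup>+b. (urn_gap \<beta>1 \<beta>2 b - m)\<^sup>2 + urn_variance \<beta>1 \<beta>2 b \<partial>urn_step \<beta>1 \<beta>2 a)
     = ennreal (((d - 1 / f)\<^sup>2 + (v - (1 / f)\<^sup>2)) * p + ((d + 1 / g)\<^sup>2 + (v - (1 / g)\<^sup>2)) * (1 - p))"
    using p V[of "(Suc x, y)"] V[of "(x, Suc y)"]
    by (simp add: urn_step_def xy 1 2 flip: f_def g_def p_def ennreal_mult' ennreal_plus)
  also have "((d - 1 / f)\<^sup>2 + (v - (1 / f)\<^sup>2)) * p + ((d + 1 / g)\<^sup>2 + (v - (1 / g)\<^sup>2)) * (1 - p)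
     = (d\<^sup>2 + v) * (p + (1 - p)) - 2 * d * (p / f - (1 - p) / g)"
    by (simp add: power2_eq_square algebra_simps diff_divide_distrib)
  also have "p / f - (1 - p) / g = 0"
    unfolding q using fg by (simp add: p_def)
  finally show ?thesis by (simp add: d_def v_def)
qed

text \<open>
  Markov's inequality for the harmonic function centred at the initial gap, where its value is the
  initial variance alone.
\<close>

lemma urn_Chebyshev:
  assumes b: "1 < \<beta>1" "1 < \<beta>2" and xy: "x \<ge> 1" "y \<ge> 1" and \<delta>: "\<delta> > 0"
    and mc: "markov_chain M X (urn_step \<beta>1 \<beta>2) (x, y)"
  shows "1 - urn_variance \<beta>1 \<beta>2 (x, y) / \<delta>\<^sup>2
    \<le> \<P>(\<omega> in M. \<bar>urn_gap \<beta>1 \<beta>2 (X t \<omega>) - urn_gap \<beta>1 \<beta>2 (x, y)\<bar> < \<delta>)"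
proof -
  interpret markov_chain M X "urn_step \<beta>1 \<beta>2" "(x, y)" by fact
  note measurable_X[measurable]
  define m where "m = urn_gap \<beta>1 \<beta>2 (x, y)"
  let ?\<phi> = "\<lambda>a. (urn_gap \<beta>1 \<beta>2 a - m)\<^sup>2 + urn_variance \<beta>1 \<beta>2 a"
  let ?S = "{a :: nat \<times> nat. fst a \<ge> 1 \<and> snd a \<ge> 1}"
  have V: "urn_variance \<beta>1 \<beta>2 b \<ge> 0" for b
    using b by (auto simp: urn_variance_def intro!: add_nonneg_nonneg powr_tail_nonneg)
  have "\<P>(\<omega> in M. \<delta>\<^sup>2 \<le> ?\<phi> (X t \<omega>)) \<le> ?\<phi> (x, y) / \<delta>\<^sup>2"
  proof (rule superharmonic_Markov_inequality[OF mc, where S = ?S])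
    show "set_pmf (urn_step \<beta>1 \<beta>2 a) \<subseteq> ?S" if "a \<in> ?S" for a
      using that set_pmf_urn_step[of \<beta>1 \<beta>2 a] by auto
  qed (use xy \<delta> V urn_second_moment_harmonic[OF b] in auto)
  moreover have "\<P>(\<omega> in M. \<not> \<delta>\<^sup>2 \<le> ?\<phi> (X t \<omega>)) = 1 - \<P>(\<omega> in M. \<delta>\<^sup>2 \<le> ?\<phi> (X t \<omega>))"
    by (rule prob_neg) measurable
  moreover have "\<P>(\<omega> in M. \<not> \<delta>\<^sup>2 \<le> ?\<phi> (X t \<omega>)) \<le> \<P>(\<omega> in M. \<bar>urn_gap \<beta>1 \<beta>2 (X t \<omega>) - m\<bar> < \<delta>)"
  proof (rule finite_measure_mono)
    have "\<bar>urn_gap \<beta>1 \<beta>2 a - m\<bar> < \<delta>" if "\<not> \<delta>\<^sup>2 \<le> ?\<phi> a" for a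
      using that V[of a] \<delta> by (intro power2_less_imp_less[of "\<bar>_\<bar>"]) auto
    then show "{\<omega> \<in> space M. \<not> \<delta>\<^sup>2 \<le> ?\<phi> (X t \<omega>)} \<subseteq> {\<omega> \<in> space M. \<bar>urn_gap \<beta>1 \<beta>2 (X t \<omega>) - m\<bar> < \<delta>}"
      by blast
  qed measurable
  ultimately show ?thesis by (simp add: m_def)
qed

text \<open>
  A bounded nondecreasing sequence of natural numbers attains its maximum; once \<open>snd\<close> has done so,
  every move has to increase \<open>fst\<close>.
\<close>

lemma all_but_finitely_many_in_bin1I:
  assumes steps: "\<forall>t. z (Suc t) \<in> {(Suc (fst (z t)), snd (z t)), (fst (z t), Suc (snd (z t)))}"
    and bdd: "\<forall>t. snd (z t) \<le> n"
  shows "all_but_finitely_many_in_bin1 z"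
proof -
  have mono: "snd (z s) \<le> snd (z t)" if "s \<le> t" for s t
  proof (rule lift_Suc_mono_le[OF _ that])
    show "snd (z t) \<le> snd (z (Suc t))" for t using steps[rule_format, of t] by auto
  qed
  obtain T where T: "\<And>t. snd (z t) \<le> snd (z T)"
    using ex_has_greatest_nat[of "\<lambda>_. True" 0 "\<lambda>t. snd (z t)" "Suc n"] bdd
    by (auto simp: less_Suc_eq_le)
  have "z (Suc t) = (fst (z t) + 1, snd (z t))" if "t \<ge> T" for t
    using steps[rule_format, of t] T[of "Suc t"] mono[OF that] by auto
  then show ?thesis by (auto simp: all_but_finitely_many_in_bin1_def)
qed

lemma all_but_finitely_many_in_bin2I:
  assumes steps: "\<forall>t. z (Suc t) \<in> {(Suc (fst (z t)), snd (z t)), (fst (z t), Suc (snd (z t)))}"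
    and bdd: "\<forall>t. fst (z t) \<le> n"
  shows "all_but_finitely_many_in_bin2 z"
proof -
  \<comment> \<open>Exchanging the bins reduces this to the other case.\<close>
  define w where "w t = prod.swap (z t)" for t
  have "all_but_finitely_many_in_bin1 w"
    by (rule all_but_finitely_many_in_bin1I[where n = n])
       (use steps bdd in \<open>auto simp: w_def prod_eq_iff\<close>)
  then show ?thesis
    by (auto simp: all_but_finitely_many_in_bin1_def all_but_finitely_many_in_bin2_def w_def prod_eq_iff)
qed

text \<open>
  Equality of two random states is measurable because the value of one of them ranges over a
  countable set.
\<close>

lemma sets_eventually_always_step:
  fixes X :: "nat \<Rightarrow> 'w \<Rightarrow> 's :: countable"
  assumes [measurable]: "\<And>t. X t \<in> measurable M (count_space UNIV)"
  shows "{\<omega> \<in> space M. \<exists>T. \<forall>t\<ge>T. X (Suc t) \<omega> = h (X t \<omega>)} \<in> sets M"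
proof -
  have [measurable]: "Measurable.pred M (\<lambda>\<omega>. X (Suc t) \<omega> = h (X t \<omega>))" for t
    by (rule measurable_compose_countable[where f = "\<lambda>a \<omega>. X (Suc t) \<omega> = h a" and g = "X t"]) measurable
  show ?thesis by measurable
qed

text \<open>
  The passage from bounds at each fixed time to the event \<open>A\<close>, which concerns the whole path: one
  coordinate \<open>N\<close> that stays bounded forces \<open>A\<close> on every path with legal moves. The two bins are
  the two choices of \<open>N\<close>.
\<close>

lemma prob_ge_of_bounded_component:
  fixes N :: "nat \<times> nat \<Rightarrow> nat"
  assumes mc: "markov_chain M X (urn_step \<beta>1 \<beta>2) (x, y)"
    and N: "N = fst \<or> N = snd"
    and A: "\<And>z. \<forall>t. z (Suc t) \<in> {(Suc (fst (z t)), snd (z t)), (fst (z t), Suc (snd (z t)))} \<Longrightarrow>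
         \<forall>t. N (z t) \<le> n \<Longrightarrow> A z"
    and meas: "{\<omega> \<in> space M. A (\<lambda>t. X t \<omega>)} \<in> sets M"
    and p: "\<And>t. p \<le> \<P>(\<omega> in M. N (X t \<omega>) \<le> n)"
  shows "p \<le> \<P>(\<omega> in M. A (\<lambda>t. X t \<omega>))"
proof -
  interpret markov_chain M X "urn_step \<beta>1 \<beta>2" "(x, y)" by fact
  note measurable_X[measurable]
  have steps: "AE \<omega> in M. \<forall>t. X (Suc t) \<omega>
       \<in> {(Suc (fst (X t \<omega>)), snd (X t \<omega>)), (fst (X t \<omega>), Suc (snd (X t \<omega>)))}"
    using AE_steps[OF mc] by eventually_elim (intro allI subsetD[OF set_pmf_urn_step], blast)
  have "p \<le> \<P>(\<omega> in M. \<forall>t. N (X t \<omega>) \<le> n)"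
  proof (rule prob_bounded_of_mono)
    show "AE \<omega> in M. \<forall>t. N (X t \<omega>) \<le> N (X (Suc t) \<omega>)"
      using steps
    proof eventually_elim
      case (elim \<omega>)
      have "N (X t \<omega>) \<le> N (X (Suc t) \<omega>)" for t using elim[rule_format, of t] N by auto
      then show ?case by blast
    qed
  qed (use p in auto)
  also have "\<dots> \<le> \<P>(\<omega> in M. A (\<lambda>t. X t \<omega>))"
  proof (rule finite_measure_mono_AE[OF _ meas])
    show "AE \<omega> in M. \<omega> \<in> {\<omega> \<in> space M. \<forall>t. N (X t \<omega>) \<le> n}
        \<longrightarrow> \<omega> \<in> {\<omega> \<in> space M. A (\<lambda>t. X t \<omega>)}"
      using steps
    proof eventually_elim
      case (elim \<omega>)
      then show ?case using A[of "\<lambda>t. X t \<omega>"] by simp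
    qed
  qed
  finally show ?thesis .
qed

text \<open>
  The deviation allowed to the gap is half of its initial size, so with the stated probability it
  is still below half of its negative initial value at time \<open>t\<close>. Then the tail of bin 2 is bounded
  below, that is, the load of bin 2 is bounded above, both uniformly in \<open>t\<close>. The factor 4 comes
  from the half.
\<close>

lemma prob_bin1_ge:
  assumes b: "1 < \<beta>1" "1 < \<beta>2" and xy: "x \<ge> 1" "y \<ge> 1"
    and mc: "markov_chain M X (urn_step \<beta>1 \<beta>2) (x, y)"
    and less: "powr_tail \<beta>1 x < powr_tail \<beta>2 y"
  shows "1 - 4 * (urn_variance \<beta>1 \<beta>2 (x, y) / (urn_gap \<beta>1 \<beta>2 (x, y))\<^sup>2)
    \<le> \<P>(\<omega> in M. all_but_finitely_many_in_bin1 (\<lambda>t. X t \<omega>))"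
proof -
  interpret markov_chain M X "urn_step \<beta>1 \<beta>2" "(x, y)" by fact
  note measurable_X[measurable]
  define \<delta> where "\<delta> = - urn_gap \<beta>1 \<beta>2 (x, y) / 2"
  have \<delta>: "\<delta> > 0" using less by (simp add: \<delta>_def urn_gap_def)
  obtain n where n: "\<And>k. k \<ge> n \<Longrightarrow> powr_tail \<beta>2 k < \<delta>"
    using order_tendstoD(2)[OF powr_tail_tendsto_0[OF b(2)] \<delta>] by (auto simp: eventually_sequentially)
  have "snd a \<le> n" if "\<bar>urn_gap \<beta>1 \<beta>2 a - urn_gap \<beta>1 \<beta>2 (x, y)\<bar> < \<delta>" for a
  proof -
    \<comment> \<open>The initial gap is \<open>- 2 * \<delta>\<close>, and dropping the tail of bin 1 only weakens the bound.\<close>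
    have "urn_gap \<beta>1 \<beta>2 a < - \<delta>" using that by (simp add: \<delta>_def)
    then have "powr_tail \<beta>2 (snd a) > \<delta>"
      using powr_tail_nonneg[OF b(1), of "fst a"] by (simp add: urn_gap_def)
    then show ?thesis using n[of "snd a"] by (cases "snd a \<le> n") auto
  qed
  then have "\<P>(\<omega> in M. \<bar>urn_gap \<beta>1 \<beta>2 (X t \<omega>) - urn_gap \<beta>1 \<beta>2 (x, y)\<bar> < \<delta>)
     \<le> \<P>(\<omega> in M. snd (X t \<omega>) \<le> n)" for t
    by (intro finite_measure_mono) (simp_all add: Collect_mono_iff)
  with urn_Chebyshev[OF b xy \<delta> mc] have p: "1 - urn_variance \<beta>1 \<beta>2 (x, y) / \<delta>\<^sup>2
      \<le> \<P>(\<omega> in M. snd (X t \<omega>) \<le> n)" for t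
    by (rule order_trans)
  have "{\<omega> \<in> space M. all_but_finitely_many_in_bin1 (\<lambda>t. X t \<omega>)} \<in> sets M"
    unfolding all_but_finitely_many_in_bin1_def
    using sets_eventually_always_step[where h = "\<lambda>a. (fst a + 1, snd a)", OF measurable_X] .
  from prob_ge_of_bounded_component[OF mc disjI2[OF refl] all_but_finitely_many_in_bin1I[where n = n] this p]
  show ?thesis by (simp add: \<delta>_def power_divide mult.commute)
qed

lemma prob_bin2_ge:
  assumes b: "1 < \<beta>1" "1 < \<beta>2" and xy: "x \<ge> 1" "y \<ge> 1"
    and mc: "markov_chain M X (urn_step \<beta>1 \<beta>2) (x, y)"
    and less: "powr_tail \<beta>2 y < powr_tail \<beta>1 x"
  shows "1 - 4 * (urn_variance \<beta>1 \<beta>2 (x, y) / (urn_gap \<beta>1 \<beta>2 (x, y))\<^sup>2)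
    \<le> \<P>(\<omega> in M. all_but_finitely_many_in_bin2 (\<lambda>t. X t \<omega>))"
proof -
  interpret markov_chain M X "urn_step \<beta>1 \<beta>2" "(x, y)" by fact
  note measurable_X[measurable]
  define \<delta> where "\<delta> = urn_gap \<beta>1 \<beta>2 (x, y) / 2"
  have \<delta>: "\<delta> > 0" using less by (simp add: \<delta>_def urn_gap_def)
  obtain n where n: "\<And>k. k \<ge> n \<Longrightarrow> powr_tail \<beta>1 k < \<delta>"
    using order_tendstoD(2)[OF powr_tail_tendsto_0[OF b(1)] \<delta>] by (auto simp: eventually_sequentially)
  have "fst a \<le> n" if "\<bar>urn_gap \<beta>1 \<beta>2 a - urn_gap \<beta>1 \<beta>2 (x, y)\<bar> < \<delta>" for a
  proof -
    have "urn_gap \<beta>1 \<beta>2 a > \<delta>" using that unfolding \<delta>_def by linarith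
    then have "powr_tail \<beta>1 (fst a) > \<delta>"
      using powr_tail_nonneg[OF b(2), of "snd a"] by (simp add: urn_gap_def)
    then show ?thesis using n[of "fst a"] by (cases "fst a \<le> n") auto
  qed
  then have "\<P>(\<omega> in M. \<bar>urn_gap \<beta>1 \<beta>2 (X t \<omega>) - urn_gap \<beta>1 \<beta>2 (x, y)\<bar> < \<delta>)
     \<le> \<P>(\<omega> in M. fst (X t \<omega>) \<le> n)" for t
    by (intro finite_measure_mono) (simp_all add: Collect_mono_iff)
  with urn_Chebyshev[OF b xy \<delta> mc] have p: "1 - urn_variance \<beta>1 \<beta>2 (x, y) / \<delta>\<^sup>2
      \<le> \<P>(\<omega> in M. fst (X t \<omega>) \<le> n)" for t
    by (rule order_trans)
  have "{\<omega> \<in> space M. all_but_finitely_many_in_bin2 (\<lambda>t. X t \<omega>)} \<in> sets M"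
    unfolding all_but_finitely_many_in_bin2_def
    using sets_eventually_always_step[where h = "\<lambda>a. (fst a, snd a + 1)", OF measurable_X] .
  from prob_ge_of_bounded_component[OF mc disjI1[OF refl] all_but_finitely_many_in_bin2I[where n = n] this p]
  show ?thesis by (simp add: \<delta>_def power_divide mult.commute)
qed

section \<open>The two phases\<close>

text \<open>
  Divide numerator and denominator by $b_n^2$: the denominator tends to $(r-1)^2 \ne 0$, and
  $v_n / b_n^2 = (v_n / a_n^2) (a_n / b_n)^2$ tends to 0. The names are neutral because
  either bin can win: \<open>a\<close> stands for the tail of the winning bin, which is the smaller one.
\<close>

lemma relative_gap_tendsto_0:
  fixes a b v w :: "nat \<Rightarrow> real"
  assumes r: "(\<lambda>n. a n / b n) \<longlonglongrightarrow> r" "r < 1"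
    and pos: "\<forall>\<^sub>F n in sequentially. a n > 0 \<and> b n > 0"
    and v: "(\<lambda>n. v n / (a n)\<^sup>2) \<longlonglongrightarrow> 0" and w: "(\<lambda>n. w n / (b n)\<^sup>2) \<longlonglongrightarrow> 0"
  shows "(\<lambda>n. (v n + w n) / (a n - b n)\<^sup>2) \<longlonglongrightarrow> 0"
    and "\<forall>\<^sub>F n in sequentially. a n < b n"
proof -
  have "(\<lambda>n. (v n / (a n)\<^sup>2 * (a n / b n)\<^sup>2 + w n / (b n)\<^sup>2) / (a n / b n - 1)\<^sup>2)
      \<longlonglongrightarrow> (0 * r\<^sup>2 + 0) / (r - 1)\<^sup>2"
    using r(2) by (intro tendsto_intros r v w) auto
  then have "(\<lambda>n. (v n / (a n)\<^sup>2 * (a n / b n)\<^sup>2 + w n / (b n)\<^sup>2) / (a n / b n - 1)\<^sup>2) \<longlonglongrightarrow> 0" by simp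
  then show "(\<lambda>n. (v n + w n) / (a n - b n)\<^sup>2) \<longlonglongrightarrow> 0"
  proof (rule Lim_transform_eventually)
    show "\<forall>\<^sub>F n in sequentially.
      (v n / (a n)\<^sup>2 * (a n / b n)\<^sup>2 + w n / (b n)\<^sup>2) / (a n / b n - 1)\<^sup>2 = (v n + w n) / (a n - b n)\<^sup>2"
      using pos
    proof eventually_elim
      case (elim n)
      have "a n / b n - 1 = (a n - b n) / b n" using elim by (simp add: field_simps)
      moreover have "v n / (a n)\<^sup>2 * (a n / b n)\<^sup>2 + w n / (b n)\<^sup>2 = (v n + w n) / (b n)\<^sup>2"
        using elim by (simp add: power_divide add_divide_distrib)
      ultimately show ?case using elim by (simp add: power_divide)
    qed
  qed
  show "\<forall>\<^sub>F n in sequentially. a n < b n"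
    using pos order_tendstoD(2)[OF r] by eventually_elim (simp add: field_simps)
qed

text \<open>
  Insert $y \sim \nu x^\alpha$ into the asymptotics of both tails. The power of $x$ is divided out
  so that the critical and the non-critical cases can be read off from one finite positive limit.
\<close>

lemma powr_tail_quotient_asymptotic:
  assumes b: "1 < \<beta>1" "1 < \<beta>2" and "0 < \<alpha>" "0 < \<nu>"
    and y1: "\<And>x. x \<ge> 1 \<Longrightarrow> y x \<ge> 1"
    and y: "(\<lambda>x. real (y x) - \<nu> * real x powr \<alpha>) \<in> o(\<lambda>x. real x powr \<alpha>)"
  shows "filterlim y at_top sequentially"
    and "(\<lambda>x. powr_tail \<beta>1 x / powr_tail \<beta>2 (y x) / real x powr (\<alpha> * (\<beta>2 - 1) - (\<beta>1 - 1)))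
           \<longlonglongrightarrow> \<nu> powr (\<beta>2 - 1) / \<alpha>_cr \<beta>1 \<beta>2"
proof -
  have "(\<lambda>x. (real (y x) - \<nu> * real x powr \<alpha>) / real x powr \<alpha>) \<longlonglongrightarrow> 0"
    using smalloD_tendsto[OF y] .
  from tendsto_add[OF this tendsto_const[of \<nu>]]
  have "(\<lambda>x. (real (y x) - \<nu> * real x powr \<alpha>) / real x powr \<alpha> + \<nu>) \<longlonglongrightarrow> \<nu>"
    by simp
  then have lim: "(\<lambda>x. real (y x) / real x powr \<alpha>) \<longlonglongrightarrow> \<nu>"
    by (rule Lim_transform_eventually)
       (use eventually_gt_at_top[of 0] in eventually_elim, simp add: field_simps)
  have xa: "filterlim (\<lambda>x. real x powr \<alpha>) at_top sequentially"
  proof -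
    have "filterlim (\<lambda>x. inverse (real x powr - \<alpha>)) at_top sequentially"
      using assms(3) by (intro filterlim_inverse_at_top tendsto_neg_powr filterlim_real_sequentially)
        (auto intro!: eventually_mono[OF eventually_gt_at_top[of 0]])
    then show ?thesis by (simp add: powr_minus)
  qed
  have "filterlim (\<lambda>x. real (y x) / real x powr \<alpha> * real x powr \<alpha>) at_top sequentially"
    by (rule filterlim_tendsto_pos_mult_at_top[OF lim _ xa]) fact
  then have "filterlim (\<lambda>x. real (y x)) at_top sequentially"
    by (rule filterlim_cong[THEN iffD1, rotated -1, OF _ refl refl])
      (use eventually_gt_at_top[of 0] in eventually_elim, simp)
  then have "\<forall>\<^sub>F x in sequentially. real Z \<le> real (y x)" for Z
    by (simp add: filterlim_at_top del: of_nat_le_iff)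
  then show ytop: "filterlim y at_top sequentially"
    by (simp add: filterlim_at_top)
  have t2: "(\<lambda>x. powr_tail \<beta>2 (y x) * real (y x) powr (\<beta>2 - 1)) \<longlonglongrightarrow> 1 / (\<beta>2 - 1)"
    using filterlim_compose[OF powr_tail_asymptotic[OF b(2)] ytop] by simp
  have "(\<lambda>x. (powr_tail \<beta>1 x * real x powr (\<beta>1 - 1)) / (powr_tail \<beta>2 (y x) * real (y x) powr (\<beta>2 - 1))
        * (real (y x) / real x powr \<alpha>) powr (\<beta>2 - 1))
      \<longlonglongrightarrow> (1 / (\<beta>1 - 1)) / (1 / (\<beta>2 - 1)) * \<nu> powr (\<beta>2 - 1)"
    using assms by (intro tendsto_intros powr_tail_asymptotic t2 lim) auto
  also have "(1 / (\<beta>1 - 1)) / (1 / (\<beta>2 - 1)) * \<nu> powr (\<beta>2 - 1) = \<nu> powr (\<beta>2 - 1) / \<alpha>_cr \<beta>1 \<beta>2"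
    by (simp add: \<alpha>_cr_def)
  finally show "(\<lambda>x. powr_tail \<beta>1 x / powr_tail \<beta>2 (y x) / real x powr (\<alpha> * (\<beta>2 - 1) - (\<beta>1 - 1)))
           \<longlonglongrightarrow> \<nu> powr (\<beta>2 - 1) / \<alpha>_cr \<beta>1 \<beta>2"
  proof (rule Lim_transform_eventually)
    show "\<forall>\<^sub>F x in sequentially.
       (powr_tail \<beta>1 x * real x powr (\<beta>1 - 1)) / (powr_tail \<beta>2 (y x) * real (y x) powr (\<beta>2 - 1))
        * (real (y x) / real x powr \<alpha>) powr (\<beta>2 - 1)
       = powr_tail \<beta>1 x / powr_tail \<beta>2 (y x) / real x powr (\<alpha> * (\<beta>2 - 1) - (\<beta>1 - 1))"
      using eventually_ge_at_top[of 1]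
    proof eventually_elim
      case (elim x)
      show ?case using elim y1[OF elim]
        by (simp add: powr_divide powr_powr powr_diff[of "real x" "\<alpha> * (\<beta>2 - 1)" "\<beta>1 - 1"])
    qed
  qed
qed

lemma tendsto_1_of_prob_bound:
  fixes p r :: "nat \<Rightarrow> real"
  assumes "\<forall>\<^sub>F x in sequentially. 1 - c * r x \<le> p x" "r \<longlonglongrightarrow> 0"
    and "\<forall>\<^sub>F x in sequentially. p x \<le> 1"
  shows "p \<longlonglongrightarrow> 1"
proof (rule real_tendsto_sandwich[OF assms(1,3)])
  show "(\<lambda>x. 1 - c * r x) \<longlonglongrightarrow> 1"
    using tendsto_diff[OF tendsto_const tendsto_mult[OF tendsto_const assms(2)]] by simp
qed auto

theorem theorem2p2:
  fixes \<beta>1 \<beta>2 \<alpha> \<nu> :: real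
    and P :: "nat \<times> nat \<Rightarrow> 'w measure"
    and X :: "nat \<Rightarrow> 'w \<Rightarrow> nat \<times> nat"
    and y :: "nat \<Rightarrow> nat"
  assumes "1 < \<beta>1" and "\<beta>1 \<le> \<beta>2"
    and "\<And>a b. a \<ge> 1 \<Longrightarrow> b \<ge> 1 \<Longrightarrow> markov_chain (P (a, b)) X (urn_step \<beta>1 \<beta>2) (a, b)"
    and "0 < \<alpha>" and "\<alpha> < 1" and "0 < \<nu>"
    and "\<And>x. x \<ge> 1 \<Longrightarrow> y x \<ge> 1"
    and "(\<lambda>x. real (y x) - \<nu> * real x powr \<alpha>) \<in> o(\<lambda>x. real x powr \<alpha>)"
  shows "(\<alpha> < \<alpha>_cr \<beta>1 \<beta>2 \<or> \<alpha> = \<alpha>_cr \<beta>1 \<beta>2 \<and> \<nu> < \<nu>_cr \<beta>1 \<beta>2 \<longrightarrow>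
           (\<lambda>x. \<P>(\<omega> in P (x, y x). all_but_finitely_many_in_bin1 (\<lambda>t. X t \<omega>))) \<longlonglongrightarrow> 1) \<and>
         (\<alpha> > \<alpha>_cr \<beta>1 \<beta>2 \<or> \<alpha> = \<alpha>_cr \<beta>1 \<beta>2 \<and> \<nu> > \<nu>_cr \<beta>1 \<beta>2 \<longrightarrow>
           (\<lambda>x. \<P>(\<omega> in P (x, y x). all_but_finitely_many_in_bin2 (\<lambda>t. X t \<omega>))) \<longlonglongrightarrow> 1)"
proof -
  note mc = assms(3) and y1 = assms(7)
  have b: "1 < \<beta>1" "1 < \<beta>2" using assms(1,2) by auto
  have acr: "\<alpha>_cr \<beta>1 \<beta>2 > 0" using b by (simp add: \<alpha>_cr_def)
  note yt = powr_tail_quotient_asymptotic[OF b assms(4,6) y1 assms(8)]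
  \<comment> \<open>The quotient of the two tails is asymptotically \<open>R * x powr e\<close>.\<close>
  define e R where "e = \<alpha> * (\<beta>2 - 1) - (\<beta>1 - 1)" and "R = \<nu> powr (\<beta>2 - 1) / \<alpha>_cr \<beta>1 \<beta>2"
  let ?a = "\<lambda>x. powr_tail \<beta>1 x" and ?b = "\<lambda>x. powr_tail \<beta>2 (y x)"
  let ?v = "\<lambda>x. powr_tail (2 * \<beta>1) x" and ?w = "\<lambda>x. powr_tail (2 * \<beta>2) (y x)"
  have lim: "(\<lambda>x. ?a x / ?b x / real x powr e) \<longlonglongrightarrow> R"
    using yt(2) by (simp add: e_def R_def)
  have R: "R > 0" using assms(6) acr by (simp add: R_def)
  have pos: "\<forall>\<^sub>F x in sequentially. ?a x > 0 \<and> ?b x > 0"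
    using eventually_ge_at_top[of 1] by eventually_elim (use y1 b powr_tail_pos in auto)
  have v: "(\<lambda>x. ?v x / (?a x)\<^sup>2) \<longlonglongrightarrow> 0" by (rule powr_tail_variance_ratio[OF b(1)])
  have w: "(\<lambda>x. ?w x / (?b x)\<^sup>2) \<longlonglongrightarrow> 0"
    using filterlim_compose[OF powr_tail_variance_ratio[OF b(2)] yt(1)] .
  have prob_le: "\<forall>\<^sub>F x in sequentially. \<P>(\<omega> in P (x, y x). Q \<omega>) \<le> 1" for Q
    using eventually_ge_at_top[of 1]
  proof eventually_elim
    case (elim x)
    interpret markov_chain "P (x, y x)" X "urn_step \<beta>1 \<beta>2" "(x, y x)" using mc y1 elim by simp
    show ?case by simp
  qed
  have xpowr: "(\<lambda>x. real x powr - c) \<longlonglongrightarrow> 0" if "c > 0" for c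
    using that by (intro tendsto_neg_powr filterlim_real_sequentially) auto
  have e_sgn: "\<alpha> < \<alpha>_cr \<beta>1 \<beta>2 \<longleftrightarrow> e < 0" "\<alpha> = \<alpha>_cr \<beta>1 \<beta>2 \<longleftrightarrow> e = 0" "\<alpha> > \<alpha>_cr \<beta>1 \<beta>2 \<longleftrightarrow> e > 0"
    using b by (auto simp: e_def \<alpha>_cr_def field_simps)
  have cr_powr: "\<nu>_cr \<beta>1 \<beta>2 powr (\<beta>2 - 1) = \<alpha>_cr \<beta>1 \<beta>2"
    using b acr by (simp add: \<nu>_cr_def powr_powr)
  have cr_pos: "\<nu>_cr \<beta>1 \<beta>2 > 0" using acr by (simp add: \<nu>_cr_def)
  show ?thesis
  proof (intro conjI impI)
    assume sub: "\<alpha> < \<alpha>_cr \<beta>1 \<beta>2 \<or> \<alpha> = \<alpha>_cr \<beta>1 \<beta>2 \<and> \<nu> < \<nu>_cr \<beta>1 \<beta>2"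
    obtain r where r: "r < 1" "(\<lambda>x. ?a x / ?b x) \<longlonglongrightarrow> r"
    proof (cases "e < 0")
      case True
      have "(\<lambda>x. ?a x / ?b x / real x powr e * real x powr - (- e)) \<longlonglongrightarrow> R * 0"
        using True by (intro tendsto_mult lim xpowr) auto
      then have "(\<lambda>x. ?a x / ?b x) \<longlonglongrightarrow> R * 0"
        by (rule Lim_transform_eventually) (use eventually_gt_at_top[of 0] in eventually_elim, simp)
      then show ?thesis using that[of 0] by simp
    next
      case False
      with sub have *: "e = 0" "\<nu> < \<nu>_cr \<beta>1 \<beta>2" by (auto simp: e_sgn)
      then have "\<nu> powr (\<beta>2 - 1) < \<alpha>_cr \<beta>1 \<beta>2"
        unfolding cr_powr[symmetric] using assms(6) b by (intro powr_less_mono2) auto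
      then have "R < 1" using acr by (simp add: R_def)
      moreover have "(\<lambda>x. ?a x / ?b x) \<longlonglongrightarrow> R"
        using lim by (rule Lim_transform_eventually)
          (use eventually_gt_at_top[of 0] in eventually_elim, simp add: *)
      ultimately show ?thesis using that by blast
    qed
    note gap = relative_gap_tendsto_0[OF r(2,1) pos v w]
    show "(\<lambda>x. \<P>(\<omega> in P (x, y x). all_but_finitely_many_in_bin1 (\<lambda>t. X t \<omega>))) \<longlonglongrightarrow> 1"
    proof (rule tendsto_1_of_prob_bound[OF _ gap(1) prob_le])
      show "\<forall>\<^sub>F x in sequentially. 1 - 4 * ((?v x + ?w x) / (?a x - ?b x)\<^sup>2)
          \<le> \<P>(\<omega> in P (x, y x). all_but_finitely_many_in_bin1 (\<lambda>t. X t \<omega>))"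
        using gap(2) eventually_ge_at_top[of 1]
      proof eventually_elim
        case (elim x)
        then show ?case
          using prob_bin1_ge[OF b elim(2) y1[OF elim(2)] mc[OF elim(2) y1[OF elim(2)]] elim(1)]
          by (simp add: urn_gap_def urn_variance_def)
      qed
    qed
  next
    assume super: "\<alpha> > \<alpha>_cr \<beta>1 \<beta>2 \<or> \<alpha> = \<alpha>_cr \<beta>1 \<beta>2 \<and> \<nu> > \<nu>_cr \<beta>1 \<beta>2"
    have lim': "(\<lambda>x. inverse (?a x / ?b x / real x powr e)) \<longlonglongrightarrow> inverse R"
      using R by (intro tendsto_inverse lim) auto
    obtain r where r: "r < 1" "(\<lambda>x. ?b x / ?a x) \<longlonglongrightarrow> r"
    proof (cases "e > 0")
      case True
      have "(\<lambda>x. inverse (?a x / ?b x / real x powr e) * real x powr - e) \<longlonglongrightarrow> inverse R * 0"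
        using True by (intro tendsto_mult lim' xpowr) auto
      then have "(\<lambda>x. ?b x / ?a x) \<longlonglongrightarrow> inverse R * 0"
        by (rule Lim_transform_eventually)
          (use eventually_gt_at_top[of 0] in eventually_elim, simp add: powr_minus field_simps)
      then show ?thesis using that[of 0] by simp
    next
      case False
      with super have *: "e = 0" "\<nu> > \<nu>_cr \<beta>1 \<beta>2" by (auto simp: e_sgn)
      then have "\<nu> powr (\<beta>2 - 1) > \<alpha>_cr \<beta>1 \<beta>2"
        unfolding cr_powr[symmetric] using cr_pos b by (intro powr_less_mono2) auto
      then have "inverse R < 1" using acr assms(6) by (simp add: R_def divide_less_eq)
      moreover have "(\<lambda>x. ?b x / ?a x) \<longlonglongrightarrow> inverse R"
        using lim' by (rule Lim_transform_eventually)
          (use eventually_gt_at_top[of 0] in eventually_elim, simp add: *)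
      ultimately show ?thesis using that by blast
    qed
    have pos': "\<forall>\<^sub>F x in sequentially. ?b x > 0 \<and> ?a x > 0"
      using pos by eventually_elim simp
    note gap = relative_gap_tendsto_0[OF r(2,1) pos' w v]
    show "(\<lambda>x. \<P>(\<omega> in P (x, y x). all_but_finitely_many_in_bin2 (\<lambda>t. X t \<omega>))) \<longlonglongrightarrow> 1"
    proof (rule tendsto_1_of_prob_bound[OF _ gap(1) prob_le])
      show "\<forall>\<^sub>F x in sequentially. 1 - 4 * ((?w x + ?v x) / (?b x - ?a x)\<^sup>2)
          \<le> \<P>(\<omega> in P (x, y x). all_but_finitely_many_in_bin2 (\<lambda>t. X t \<omega>))"
        using gap(2) eventually_ge_at_top[of 1]
      proof eventually_elim
        case (elim x)
        then show ?case
          using prob_bin2_ge[OF b elim(2) y1[OF elim(2)] mc[OF elim(2) y1[OF elim(2)]] elim(1)]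
          by (simp add: urn_gap_def urn_variance_def power2_commute[of "?b x" "?a x"] add.commute)
      qed
    qed
  qed
qed

end
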